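(* Let $\mathcal K$ be a finite simplicial complex satisfying the standing assumptions, let $1\le q\le\dim\mathcal K$, and write $D=D_q^{\mathrm{down}}$. There exists a function $\theta:K_q\to\{\pm1\}$ such that $\theta(\overline\tau)=\theta(\tau)$ for all $\tau\in K_q$ and $D^\theta=-D$ if and only if the down graph $Y_q$ is bipartite. Therefore, if $Y_q$ is bipartite, then the eigenvalues of $D$ are symmetric about the origin.
   Context: Complexes. $\mathcal K=(V,\mathcal S)$ is an abstract simplicial complex: $V$ is a countable set, $\mathcal S$ is a family of finite subsets of $V$ closed under taking subsets, containing $\emptyset$ and all singletons. $\mathcal S_q$ is the set of simplices with $q+1$ elements (dimension $q$). Standing assumptions: (bounded degree) there is a constant $c$ such that every nonempty $F\in\mathcal S$ is contained in at most $c$ elements of $\mathcal S$; (finite dimension) $\dim\mathcal K:=\max\{\dim F: F\in\mathcal S\}<\infty$, and $\dim\mathcal K\ge 1$; (pure) every simplex is contained in a simplex of dimension $\dim\mathcal K$; (strongly connected) any two $\sigma_1,\sigma_2\in\mathcal S_{\dim\mathcal K}$ are joined by a sequence $\sigma_1=\tau_1,\dots,\tau_m=\sigma_2$ in $\mathcal S_{\dim\mathcal K}$ with $\tau_i\cap\tau_{i+1}\in\mathcal S_{\dim\mathcal K-1}$. Orientations. $\widehat K_q$ is the set of sequences $s=(a_0\cdots a_q)$ with $\{a_0,\dots,a_q\}\in\mathcal S_q$; $\mathfrak S_{q+1}$ acts by $s^\pi=(a_{\pi(0)}\cdots a_{\pi(q)})$. For $q\ge1$, $K_q=\widehat K_q/\mathfrak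 A_{q+1}$ (alternating group) is the set of oriented $q$-simplices; the class of $s$ is $\langle s\rangle$. Each $q$-simplex has two orientations, $\tau$ and its opposite $\overline\tau$. For $q=0$, $K_0=V\times\{\pm1\}$, $\langle (a)\rangle=(a,+1)$, $\overline{(a,\varepsilon)}=(a,-\varepsilon)$. $[\tau]\in\mathcal S_q$ denotes the underlying simplex of $\tau$. For $\sigma=\langle a_0\cdots a_q\rangle\in K_q$ and $\tau\in K_{q-1}$: $\mathrm{sgn}(\sigma,\tau)=(-1)^j$ if $\tau=\langle a_0\cdots\widehat{a_j}\cdots a_q\rangle$, $\mathrm{sgn}(\sigma,\tau)=-(-1)^j$ if $\overline\tau=\langle a_0\cdots\widehat{a_j}\cdots a_q\rangle$, and $\mathrm{sgn}(\sigma,\tau)=0$ if $[\tau]\not\subset[\sigma]$. Down graph and discriminant. Distinct $[\tau_1],[\tau_2]\in\mathcal S_q$ ($q\ge1$) are down neighbors if $[\tau_1]\cap[\tau_2]\in\mathcal S_{q-1}$. The down graph $Y_q$ has vertex set $K_q$ and edges the pairs $(\tau_1,\tau_2)\in K_q\times K_q$ with $[\tau_1],[\tau_2]$ (distinct) down neighbors. $\deg_Y(\tau)$ is the number of $[\tau']\in\mathcal S_q$ that are down neighbors of $[\tau]$. If $q=\dim\mathcal K$ it is assumed that $\mathcal S_q$ has at least two elements, so that $\deg_Y\ge1$. For down neighbors put $\eta^{\mathrm{down}}(\tau_1,\tau_2)=\mathrm{sgn}(\tau_1,\mu)\,\mathrm{sgn}(\tau_2,\mu)$, where $\mu\in K_{q-1}$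 is either orientation of $[\tau_1]\cap[\tau_2]$. The down discriminant on $\ell^2(K_q)$ is $$(D_q^{\mathrm{down}}g)(\tau)=\sum_{\tau':(\tau,\tau')\in E(Y_q)}\frac{\eta^{\mathrm{down}}(\tau,\tau')}{\sqrt{2\deg_Y(\tau)}\sqrt{2\deg_Y(\tau')}}\,g(\tau').$$ Switching. For $\theta:K_q\to\{\pm1\}$ with $\theta(\overline\tau)=\theta(\tau)$, let $S^\theta$ be the diagonal operator $(S^\theta g)(\tau)=\theta(\tau)g(\tau)$ and $D^\theta=S^\theta D S^\theta$. "Symmetric about the origin" means $\sigma(D)=-\sigma(D)$, where $\sigma(D)$ is the set of eigenvalues. *)

theory Defs
  imports "HOL-Analysis.Analysis" "HOL-Combinatorics.Permutations"
begin

section \<open>Simplicial complexes\<close>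

definition simplices :: "'a set set \<Rightarrow> nat \<Rightarrow> 'a set set" where
  "simplices S q = {F \<in> S. finite F \<and> card F = Suc q}"

(* The natural-number subtraction only truncates for S = {{}}, whose dimension would be -1; 
   that case is excluded by the requirement that the dimension be at least 1. *)
definition complex_dim :: "'a set set \<Rightarrow> nat" where
  "complex_dim S = Max (card ` S) - 1"

locale simplicial_complex =
  fixes V :: "'a set" and S :: "'a set set"
  assumes countable_vertices: "countable V"
    and simplex_finite: "F \<in> S \<Longrightarrow> finite F"
    and simplex_vertices: "F \<in> S \<Longrightarrow> F \<subseteq> V"
    and subset_closed: "F \<in> S \<Longrightarrow> G \<subseteq> F \<Longrightarrow> G \<in> S"
    and empty_simplex: "{} \<in> S"
    and singleton_simplex: "a \<in> V \<Longrightarrow> {a} \<in> S"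

locale standing_complex = simplicial_complex +
  assumes bounded_degree:
      "\<exists>c::nat. \<forall>F\<in>S. F \<noteq> {} \<longrightarrow> finite {G \<in> S. F \<subseteq> G} \<and> card {G \<in> S. F \<subseteq> G} \<le> c"
    and finite_dimension: "finite (card ` S)"
    and dim_ge_1: "1 \<le> complex_dim S"
    and pure: "\<forall>F\<in>S. \<exists>G\<in>simplices S (complex_dim S). F \<subseteq> G"
    and strongly_connected:
      "\<forall>\<sigma>1\<in>simplices S (complex_dim S). \<forall>\<sigma>2\<in>simplices S (complex_dim S).
         \<exists>ts. ts \<noteq> [] \<and> hd ts = \<sigma>1 \<and> last ts = \<sigma>2 \<and> set ts \<subseteq> simplices S (complex_dim S) \<and>
           (\<forall>i. Suc i < length ts \<longrightarrow> ts ! i \<inter> ts ! Suc i \<in> simplices S (complex_dim S - 1))"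

section \<open>Oriented simplices\<close>

definition ordered_simplices :: "'a set set \<Rightarrow> nat \<Rightarrow> 'a list set" where
  "ordered_simplices S q = {s. length s = Suc q \<and> set s \<in> simplices S q}"

(* An oriented vertex is a vertex with a sign in {1, -1}; an oriented simplex of positive dimension
   is an orbit of vertex sequences under the alternating group. *)
datatype 'a oriented = Signed_Vertex 'a int | Orbit "'a list set"

definition orientation :: "'a list \<Rightarrow> 'a oriented" where
  "orientation s =
     (if length s = 1 then Signed_Vertex (hd s) 1
      else Orbit {permute_list \<pi> s | \<pi>. \<pi> permutes {..<length s} \<and> evenperm \<pi>})"

definition oriented_simplices :: "'a set \<Rightarrow> 'a set set \<Rightarrow> nat \<Rightarrow> 'a oriented set" where
  "oriented_simplices V S q =
     (if q = 0 then {Signed_Vertex a \<epsilon> | a \<epsilon>. a \<in> V \<and> \<epsilon> \<in> {1, -1}}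
      else orientation ` ordered_simplices S q)"

primrec opposite :: "'a oriented \<Rightarrow> 'a oriented" where
  "opposite (Signed_Vertex a \<epsilon>) = Signed_Vertex a (- \<epsilon>)"
| "opposite (Orbit C) =
     Orbit {permute_list \<pi> s | \<pi> s. s \<in> C \<and> \<pi> permutes {..<length s} \<and> \<not> evenperm \<pi>}"

primrec underlying :: "'a oriented \<Rightarrow> 'a set" where
  "underlying (Signed_Vertex a \<epsilon>) = {a}"
| "underlying (Orbit C) = (\<Union>s\<in>C. set s)"

definition delete_nth :: "nat \<Rightarrow> 'a list \<Rightarrow> 'a list" where
  "delete_nth j s = take j s @ drop (Suc j) s"

(* For an oriented q-simplex \<sigma> and an oriented (q-1)-simplex \<tau> below it, the selected value does
   not depend on the representing sequence s of \<sigma>. *)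
definition incidence_sgn :: "'a oriented \<Rightarrow> 'a oriented \<Rightarrow> int" where
  "incidence_sgn \<sigma> \<tau> =
     (if underlying \<tau> \<subseteq> underlying \<sigma>
      then (SOME x. \<exists>s j. \<sigma> = orientation s \<and> j < length s \<and>
              (\<tau> = orientation (delete_nth j s) \<and> x = (-1) ^ j \<or>
               opposite \<tau> = orientation (delete_nth j s) \<and> x = - ((-1) ^ j)))
      else 0)"

section \<open>The down graph and the down discriminant\<close>

definition down_neighbors :: "'a set set \<Rightarrow> nat \<Rightarrow> 'a set \<Rightarrow> 'a set \<Rightarrow> bool" where
  "down_neighbors S q F G \<longleftrightarrow>
     F \<in> simplices S q \<and> G \<in> simplices S q \<and> F \<noteq> G \<and> F \<inter> G \<in> simplices S (q - 1)"

definition down_edges :: "'a set \<Rightarrow> 'a set set \<Rightarrow> nat \<Rightarrow> ('a oriented \<times> 'a oriented) set" where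
  "down_edges V S q =
     {(\<tau>1, \<tau>2) \<in> oriented_simplices V S q \<times> oriented_simplices V S q.
        down_neighbors S q (underlying \<tau>1) (underlying \<tau>2)}"

definition bipartite :: "'v set \<Rightarrow> ('v \<times> 'v) set \<Rightarrow> bool" where
  "bipartite X E \<longleftrightarrow>
     (\<exists>A B. A \<union> B = X \<and> A \<inter> B = {} \<and>
        (\<forall>(x, y)\<in>E. (x \<in> A \<and> y \<in> B) \<or> (x \<in> B \<and> y \<in> A)))"

definition down_deg :: "'a set set \<Rightarrow> nat \<Rightarrow> 'a oriented \<Rightarrow> nat" where
  "down_deg S q \<tau> = card {G \<in> simplices S q. down_neighbors S q (underlying \<tau>) G}"

(* Replacing \<mu> by its opposite changes both factors by a sign, so the choice is immaterial. *)
definition eta_down :: "'a set \<Rightarrow> 'a set set \<Rightarrow> nat \<Rightarrow> 'a oriented \<Rightarrow> 'a oriented \<Rightarrow> int" where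
  "eta_down V S q \<tau>1 \<tau>2 =
     (let \<mu> = (SOME \<mu>. \<mu> \<in> oriented_simplices V S (q - 1) \<and>
                        underlying \<mu> = underlying \<tau>1 \<inter> underlying \<tau>2)
      in incidence_sgn \<tau>1 \<mu> * incidence_sgn \<tau>2 \<mu>)"

(* Functions on X are represented by functions on the whole type that vanish outside X. *)
definition ell2 :: "'v set \<Rightarrow> ('v \<Rightarrow> complex) set" where
  "ell2 X = {g. (\<forall>x. x \<notin> X \<longrightarrow> g x = 0) \<and> (\<lambda>x. (cmod (g x))\<^sup>2) summable_on X}"

definition down_discriminant ::
  "'a set \<Rightarrow> 'a set set \<Rightarrow> nat \<Rightarrow> ('a oriented \<Rightarrow> complex) \<Rightarrow> 'a oriented \<Rightarrow> complex" where
  "down_discriminant V S q g \<tau> =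
     (\<Sum>\<tau>' | (\<tau>, \<tau>') \<in> down_edges V S q.
        complex_of_real
          (of_int (eta_down V S q \<tau> \<tau>') /
             (sqrt (2 * real (down_deg S q \<tau>)) * sqrt (2 * real (down_deg S q \<tau>')))) * g \<tau>')"

section \<open>Switching and eigenvalues\<close>

definition switching :: "('v \<Rightarrow> int) \<Rightarrow> ('v \<Rightarrow> complex) \<Rightarrow> 'v \<Rightarrow> complex" where
  "switching \<theta> g x = of_int (\<theta> x) * g x"

definition switched ::
  "('v \<Rightarrow> int) \<Rightarrow> (('v \<Rightarrow> complex) \<Rightarrow> 'v \<Rightarrow> complex) \<Rightarrow> ('v \<Rightarrow> complex) \<Rightarrow> 'v \<Rightarrow> complex" where
  "switched \<theta> T = switching \<theta> \<circ> T \<circ> switching \<theta>"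

definition eigenvalues ::
  "('v \<Rightarrow> complex) set \<Rightarrow> (('v \<Rightarrow> complex) \<Rightarrow> 'v \<Rightarrow> complex) \<Rightarrow> complex set" where
  "eigenvalues H T = {z. \<exists>g\<in>H. g \<noteq> (\<lambda>_. 0) \<and> T g = (\<lambda>x. z * g x)}"

definition symmetric_about_origin :: "complex set \<Rightarrow> bool" where
  "symmetric_about_origin A \<longleftrightarrow> A = uminus ` A"

end

theory Submission
  imports Defs
begin

text \<open>
  On an edge of the down graph the matrix entry of \<open>D\<close> is nonzero, and switching multiplies it by
  \<open>\<theta>(\<tau>) \<theta>(\<tau>')\<close>. Hence \<open>D\<^sup>\<theta> = - D\<close> says exactly that \<open>\<theta>\<close> changes sign along every edge, that is,
  the level sets of \<open>\<theta>\<close> form a bipartition. Adjacency only depends on underlying simplices, so the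
  sign function of a bipartition can be chosen invariant under reversal of orientation.
  If \<open>D\<^sup>\<theta> = - D\<close>, then \<open>S\<^sup>\<theta>\<close> maps eigenvectors for \<open>z\<close> to eigenvectors for \<open>- z\<close>.
\<close>

section \<open>Orientations\<close>

text \<open>Left composition with \<open>\<pi>\<close> is a bijection on the permutations of the
  positions and shifts parity by that of \<open>\<pi>\<close>. The parameter \<open>b\<close> lets
  one statement serve both classes.\<close>

lemma permute_list_parity_orbit:
  assumes "\<pi> permutes {..<length u}"
  shows "{permute_list \<rho> (permute_list \<pi> u) |\<rho>. \<rho> permutes {..<length u} \<and> evenperm \<rho> = b} =
         {permute_list \<sigma> u |\<sigma>. \<sigma> permutes {..<length u} \<and> evenperm \<sigma> = (evenperm \<pi> = b)}"
    (is "?L = ?R")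
proof
  have perm: "permutation \<rho>" if "\<rho> permutes {..<length u}" for \<rho>
    using that permutation_permutes by blast
  show "?L \<subseteq> ?R"
  proof clarify
    fix \<rho> assume \<rho>: "\<rho> permutes {..<length u}"
    have "permute_list \<rho> (permute_list \<pi> u) = permute_list (\<pi> \<circ> \<rho>) u"
      using \<rho> by (simp add: permute_list_compose)
    moreover have "\<pi> \<circ> \<rho> permutes {..<length u}"
      using \<rho> assms by (rule permutes_compose)
    moreover have "evenperm (\<pi> \<circ> \<rho>) = (evenperm \<pi> = evenperm \<rho>)"
      using \<rho> assms perm by (simp add: evenperm_comp)
    ultimately show "\<exists>\<sigma>. permute_list \<rho> (permute_list \<pi> u) = permute_list \<sigma> u \<and>
        \<sigma> permutes {..<length u} \<and> evenperm \<sigma> = (evenperm \<pi> = evenperm \<rho>)"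
      by blast
  qed
  show "?R \<subseteq> ?L"
  proof clarify
    fix \<sigma> assume \<sigma>: "\<sigma> permutes {..<length u}" "evenperm \<sigma> = (evenperm \<pi> = b)"
    \<comment> \<open>The solution of \<open>\<pi> \<circ> \<rho> = \<sigma>\<close> is
      \<open>inv \<pi> \<circ> \<sigma>\<close>.\<close>
    have inv: "inv \<pi> permutes {..<length u}"
      using assms by (rule permutes_inv)
    have \<rho>: "inv \<pi> \<circ> \<sigma> permutes {..<length u}"
      using \<sigma>(1) inv by (rule permutes_compose)
    have "\<pi> \<circ> (inv \<pi> \<circ> \<sigma>) = \<sigma>"
      using permutes_inv_o(1)[OF assms] by (simp flip: comp_assoc)
    then have "permute_list \<sigma> u = permute_list (inv \<pi> \<circ> \<sigma>) (permute_list \<pi> u)"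
      using permute_list_compose[OF \<rho>, of \<pi>] by simp
    moreover have "evenperm (inv \<pi> \<circ> \<sigma>) = b"
      using \<sigma> assms inv perm by (auto simp: evenperm_comp evenperm_inv)
    ultimately show "\<exists>\<rho>. permute_list \<sigma> u = permute_list \<rho> (permute_list \<pi> u) \<and>
        \<rho> permutes {..<length u} \<and> evenperm \<rho> = b"
      using \<rho> by blast
  qed
qed

lemma orientation_permute_even:
  assumes "\<pi> permutes {..<length u}" "evenperm \<pi>" "length u \<noteq> 1"
  shows "orientation (permute_list \<pi> u) = orientation u"
  using permute_list_parity_orbit[OF assms(1), of True] assms
  by (simp add: orientation_def)

text \<open>\<open>opposite\<close> collects the odd rearrangements of every member of the class.
  Members differ by even permutations, so each contributes the same set and a single representative
  suffices.\<close>

lemma opposite_orientation: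
  assumes "length t \<noteq> 1"
  shows "opposite (orientation t) =
    Orbit {permute_list \<rho> t |\<rho>. \<rho> permutes {..<length t} \<and> \<not> evenperm \<rho>}" (is "_ = Orbit ?O")
proof -
  have odd: "{permute_list \<rho> (permute_list \<sigma> t) |\<rho>. \<rho> permutes {..<length t} \<and> \<not> evenperm \<rho>} = ?O"
    if "\<sigma> permutes {..<length t}" "evenperm \<sigma>" for \<sigma>
    using permute_list_parity_orbit[OF that(1), of False] that(2) by simp
  have "{permute_list \<rho> s |\<rho> s. s \<in> {permute_list \<sigma> t |\<sigma>. \<sigma> permutes {..<length t} \<and> evenperm \<sigma>} \<and>
            \<rho> permutes {..<length s} \<and> \<not> evenperm \<rho>} =
        (\<Union>\<sigma>\<in>{\<sigma>. \<sigma> permutes {..<length t} \<and> evenperm \<sigma>}.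
            {permute_list \<rho> (permute_list \<sigma> t) |\<rho>. \<rho> permutes {..<length t} \<and> \<not> evenperm \<rho>})"
    by fastforce
  also have "\<dots> = (\<Union>\<sigma>\<in>{\<sigma>. \<sigma> permutes {..<length t} \<and> evenperm \<sigma>}. ?O)"
    by (rule SUP_cong[OF refl]) (use odd in blast)
  also have "\<dots> = ?O"
    \<comment> \<open>The identity makes the index set nonempty, so the constant union
      collapses.\<close>
    using permutes_id[of "{..<length t}"] evenperm_id by blast
  finally show ?thesis
    using assms by (simp add: orientation_def)
qed

lemma opposite_orientation_permute_odd:
  assumes "\<pi> permutes {..<length u}" "\<not> evenperm \<pi>" "length u \<noteq> 1"
  shows "opposite (orientation (permute_list \<pi> u)) = orientation u"
  using permute_list_parity_orbit[OF assms(1), of False] assms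
  by (simp add: opposite_orientation) (simp add: orientation_def)

lemma underlying_orientation [simp]:
  "underlying (orientation s) = set s"
proof (cases "length s = 1")
  case True
  then show ?thesis by (cases s) (auto simp: orientation_def)
next
  case False
  have "id permutes {..<length s}" by (rule permutes_id)
  then have "\<exists>\<pi>. \<pi> permutes {..<length s} \<and> evenperm \<pi>" using evenperm_id by blast
  then show ?thesis using False by (fastforce simp: orientation_def)
qed

lemma underlying_opposite_orientation:
  "underlying (opposite (orientation s)) = set s" if "s \<noteq> []"
proof (cases "length s = 1")
  case True
  then show ?thesis by (cases s) (auto simp: orientation_def)
next
  case False
  with that have "1 < length s" by (cases s) auto
  \<comment> \<open>Swapping the first two positions shows that the odd class is nonempty.\<close>
  then have "Transposition.transpose 0 1 permutes {..<length s}" by (intro permutes_swap_id) auto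
  moreover have "\<not> evenperm (Transposition.transpose 0 (1::nat))" by (simp add: evenperm_swap)
  ultimately have "\<exists>\<pi>. \<pi> permutes {..<length s} \<and> \<not> evenperm \<pi>" by blast
  then show ?thesis using False by (fastforce simp: opposite_orientation)
qed

text \<open>The two sequences differ by a permutation, and its parity decides between the
  alternatives.\<close>

lemma orientation_eq_or_opposite:
  assumes "mset t = mset u" "length u \<noteq> 1"
  shows "orientation t = orientation u \<or> opposite (orientation t) = orientation u"
proof -
  obtain \<pi> where "\<pi> permutes {..<length u}" "permute_list \<pi> u = t"
    using mset_eq_permutation[OF assms(1)] by blast
  then show ?thesis
    using orientation_permute_even opposite_orientation_permute_odd assms(2) by metis
qed

section \<open>Deleted entries and representatives of oriented simplices\<close>

lemma length_delete_nth: "j < length s \<Longrightarrow> length (delete_nth j s) = length s - 1"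
  by (simp add: delete_nth_def)

lemma mset_delete_nth: "j < length s \<Longrightarrow> mset (delete_nth j s) = mset s - {#s ! j#}"
proof -
  assume "j < length s"
  then have "mset s = mset (take j s @ s ! j # drop (Suc j) s)"
    using id_take_nth_drop by metis
  then show ?thesis by (simp add: delete_nth_def)
qed

lemma ordered_simplices_distinct: "s \<in> ordered_simplices S q \<Longrightarrow> distinct s"
  by (simp add: ordered_simplices_def simplices_def card_distinct)

lemma oriented_simplices_pos:
  "1 \<le> q \<Longrightarrow> oriented_simplices V S q = orientation ` ordered_simplices S q"
  by (simp add: oriented_simplices_def)

text \<open>Makes any sign defined through adjacency invariant under reversal.\<close>

lemma underlying_opposite:
  assumes "1 \<le> q" "\<tau> \<in> oriented_simplices V S q"
  shows "underlying (opposite \<tau>) = underlying \<tau>"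
proof -
  obtain s where "\<tau> = orientation s" "s \<in> ordered_simplices S q"
    using assms oriented_simplices_pos by blast
  moreover from this have "s \<noteq> []" by (auto simp: ordered_simplices_def)
  ultimately show ?thesis by (simp add: underlying_opposite_orientation)
qed

text \<open>Ensures that the choice of \<open>\<mu>\<close> in \<open>eta_down\<close> yields an
  actual orientation of the common face.\<close>

lemma oriented_simplex_exists:
  assumes "simplicial_complex V S" "F \<in> simplices S q"
  shows "\<exists>\<mu>\<in>oriented_simplices V S q. underlying \<mu> = F"
proof (cases "q = 0")
  case True
  interpret simplicial_complex V S by fact
  from assms(2) True obtain a where "F = {a}"
    by (auto simp: simplices_def card_1_singleton_iff)
  moreover from this have "a \<in> V"
    using assms(2) simplex_vertices by (auto simp: simplices_def)
  ultimately show ?thesis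
    using True by (intro bexI[of _ "Signed_Vertex a 1"]) (auto simp: oriented_simplices_def)
next
  case False
  have "finite F" using assms(2) by (simp add: simplices_def)
  then obtain s where "set s = F" "distinct s"
    using finite_distinct_list by blast
  then have "set s = F" "length s = card F"
    using distinct_card by fastforce+
  then show ?thesis
    using False assms(2)
    by (intro bexI[of _ "orientation s"])
       (auto simp: oriented_simplices_def ordered_simplices_def simplices_def)
qed

section \<open>Incidence signs\<close>

text \<open>Every candidate for the chosen value is 1 or -1, so it is enough that one candidate
  exists: \<open>\<mu>\<close> or its opposite must arise by deleting an entry from a representative
  of \<open>\<tau>\<close>.\<close>

lemma incidence_sgn_nonzero:
  assumes \<tau>: "\<tau> \<in> oriented_simplices V S q" and q: "1 \<le> q"
    and \<mu>: "\<mu> \<in> oriented_simplices V S (q - 1)"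
    and sub: "underlying \<mu> \<subseteq> underlying \<tau>"
  shows "incidence_sgn \<tau> \<mu> \<noteq> 0"
proof -
  obtain s where s: "\<tau> = orientation s" "s \<in> ordered_simplices S q"
    using \<tau> q oriented_simplices_pos by blast
  then have dist: "distinct s" and len: "length s = Suc q"
    by (simp_all add: ordered_simplices_distinct) (simp add: ordered_simplices_def)
  have match: "\<exists>j<length s. \<mu> = orientation (delete_nth j s) \<or> opposite \<mu> = orientation (delete_nth j s)"
  \<comment> \<open>Faces of an edge are signed vertices, not orbits, so they are matched directly:
    deleting the other endpoint leaves \<open>a\<close>, and its sign selects \<open>\<mu>\<close>
    or \<open>opposite \<mu>\<close>.\<close>
  proof (cases "q = 1")
    case True
    with \<mu> obtain a \<epsilon> where a: "\<mu> = Signed_Vertex a \<epsilon>" "\<epsilon> \<in> {1, -1}"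
      by (auto simp: oriented_simplices_def)
    obtain x y where xy: "s = [x, y]"
      using len True by (auto simp: length_Suc_conv)
    have "a = x \<or> a = y"
      using sub s a xy by simp
    then show ?thesis
    proof
      assume "a = x"
      then show ?thesis using a xy
        by (intro exI[of _ 1]) (auto simp: delete_nth_def orientation_def)
    next
      assume "a = y"
      then show ?thesis using a xy
        by (intro exI[of _ 0]) (auto simp: delete_nth_def orientation_def)
    qed
  next
    case False
    with q have "1 \<le> q - 1" by simp
    with \<mu> obtain t where t: "\<mu> = orientation t" "t \<in> ordered_simplices S (q - 1)"
      using oriented_simplices_pos by blast
    then have tdist: "distinct t" and tlen: "length t = q"
      using q by (simp_all add: ordered_simplices_distinct) (simp add: ordered_simplices_def)
    have "set t \<subseteq> set s" using sub s t by simp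
    \<comment> \<open>The face has \<open>q\<close> of the \<open>q + 1\<close> vertices; the
      position of the missing one is the index to delete.\<close>
    moreover have "card (set s - set t) = 1"
      using calculation len tlen dist tdist by (simp add: card_Diff_subset distinct_card)
    then obtain a where a: "set s - set t = {a}"
      by (auto simp: card_1_singleton_iff)
    ultimately have t_eq: "set t = set s - {a}" by blast
    from a have "a \<in> set s" by blast
    then obtain j where j: "j < length s" "s ! j = a"
      by (auto simp: in_set_conv_nth)
    \<comment> \<open>Both lists are distinct, so equality of vertex sets lifts to multisets:
      \<open>t\<close> is a rearrangement of \<open>s\<close> without \<open>a\<close>.\<close>
    have "mset s = mset_set (insert a (set t))"
      using dist t_eq \<open>a \<in> set s\<close> by (simp add: insert_absorb flip: mset_set_set)
    also have "\<dots> = add_mset a (mset t)"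
      using tdist a by (subst mset_set.insert) (auto simp: mset_set_set)
    finally have "mset t = mset s - {#a#}" by simp
    also have "\<dots> = mset (delete_nth j s)"
      using j by (simp add: mset_delete_nth)
    finally show ?thesis
      using orientation_eq_or_opposite[of t "delete_nth j s"] t j len False
      by (auto simp: length_delete_nth)
  qed
  let ?P = "\<lambda>x::int. \<exists>s j. \<tau> = orientation s \<and> j < length s \<and>
              (\<mu> = orientation (delete_nth j s) \<and> x = (-1) ^ j \<or>
               opposite \<mu> = orientation (delete_nth j s) \<and> x = - ((-1) ^ j))"
  have "\<exists>x. ?P x" using match s(1) by blast
  then have "?P (SOME x. ?P x)" by (rule someI_ex)
  then have "(SOME x. ?P x) \<noteq> 0" by auto
  then show ?thesis using sub by (simp add: incidence_sgn_def)
qed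

text \<open>The chosen \<open>\<mu>\<close> lies below both ends of the edge, so neither factor
  vanishes.\<close>

lemma eta_down_nonzero:
  assumes "simplicial_complex V S" "1 \<le> q" "(\<tau>1, \<tau>2) \<in> down_edges V S q"
  shows "eta_down V S q \<tau>1 \<tau>2 \<noteq> 0"
proof -
  define \<mu> where "\<mu> = (SOME \<mu>. \<mu> \<in> oriented_simplices V S (q - 1) \<and>
                        underlying \<mu> = underlying \<tau>1 \<inter> underlying \<tau>2)"
  have \<tau>: "\<tau>1 \<in> oriented_simplices V S q" "\<tau>2 \<in> oriented_simplices V S q"
    "underlying \<tau>1 \<inter> underlying \<tau>2 \<in> simplices S (q - 1)"
    using assms(3) by (auto simp: down_edges_def down_neighbors_def)
  have "\<exists>\<mu>. \<mu> \<in> oriented_simplices V S (q - 1) \<and> underlying \<mu> = underlying \<tau>1 \<inter> underlying \<tau>2"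
    using oriented_simplex_exists[OF assms(1) \<tau>(3)] by blast
  then have "\<mu> \<in> oriented_simplices V S (q - 1) \<and> underlying \<mu> = underlying \<tau>1 \<inter> underlying \<tau>2"
    unfolding \<mu>_def by (rule someI_ex)
  then have "incidence_sgn \<tau>1 \<mu> \<noteq> 0" "incidence_sgn \<tau>2 \<mu> \<noteq> 0"
    using \<tau> assms(2) incidence_sgn_nonzero[where \<mu> = \<mu>] by blast+
  then show ?thesis
    unfolding eta_down_def \<mu>_def[symmetric] Let_def by simp
qed

section \<open>The down graph\<close>

lemma finite_simplices:
  assumes "simplicial_complex V S" "finite V"
  shows "finite (simplices S q)"
proof (rule finite_subset)
  show "simplices S q \<subseteq> Pow V"
    using simplicial_complex.simplex_vertices[OF assms(1)] by (auto simp: simplices_def)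
qed (simp add: assms(2))

lemma finite_oriented_simplices:
  assumes "simplicial_complex V S" "finite V" "1 \<le> q"
  shows "finite (oriented_simplices V S q)"
proof -
  have "ordered_simplices S q \<subseteq> {s. set s \<subseteq> V \<and> length s = Suc q}"
    using simplicial_complex.simplex_vertices[OF assms(1)]
    by (auto simp: ordered_simplices_def simplices_def)
  then have "finite (ordered_simplices S q)"
    using finite_lists_length_eq[OF assms(2)] by (rule finite_subset)
  then show ?thesis
    using assms(3) by (simp add: oriented_simplices_pos)
qed

lemma down_edges_sym: "(\<tau>1, \<tau>2) \<in> down_edges V S q \<Longrightarrow> (\<tau>2, \<tau>1) \<in> down_edges V S q"
  by (auto simp: down_edges_def down_neighbors_def Int_commute)

text \<open>The other end of the edge is counted. Finiteness enters because \<open>card\<close> of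
  an infinite set is 0.\<close>

lemma down_deg_pos:
  assumes "simplicial_complex V S" "finite V" "(\<tau>1, \<tau>2) \<in> down_edges V S q"
  shows "0 < down_deg S q \<tau>1"
proof -
  have "underlying \<tau>2 \<in> {G \<in> simplices S q. down_neighbors S q (underlying \<tau>1) G}"
    using assms(3) by (auto simp: down_edges_def down_neighbors_def)
  then show ?thesis
    using finite_simplices[OF assms(1,2)] unfolding down_deg_def card_gt_0_iff by auto
qed

section \<open>Matrix entries of the discriminant under switching\<close>

text \<open>On edges this is the matrix entry of the discriminant with respect to point
  masses.\<close>

definition down_weight :: "'a set \<Rightarrow> 'a set set \<Rightarrow> nat \<Rightarrow> 'a oriented \<Rightarrow> 'a oriented \<Rightarrow> complex" where
  "down_weight V S q \<tau> \<tau>' = complex_of_real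
     (of_int (eta_down V S q \<tau> \<tau>') /
        (sqrt (2 * real (down_deg S q \<tau>)) * sqrt (2 * real (down_deg S q \<tau>'))))"

lemma down_discriminant_weight:
  "down_discriminant V S q g \<tau> =
     (\<Sum>\<tau>' | (\<tau>, \<tau>') \<in> down_edges V S q. down_weight V S q \<tau> \<tau>' * g \<tau>')"
  by (simp add: down_discriminant_def down_weight_def)

text \<open>Positive degrees at both ends exclude a zero denominator, for which HOL division would
  return 0.\<close>

lemma down_weight_nonzero:
  assumes "simplicial_complex V S" "finite V" "1 \<le> q" "(\<tau>, \<tau>') \<in> down_edges V S q"
  shows "down_weight V S q \<tau> \<tau>' \<noteq> 0"
  using eta_down_nonzero[OF assms(1,3,4)] down_deg_pos[OF assms(1,2,4)]
    down_deg_pos[OF assms(1,2) down_edges_sym[OF assms(4)]]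
  by (simp add: down_weight_def)

lemma switched_discriminant:
  "switched \<theta> (down_discriminant V S q) g \<tau> =
     (\<Sum>\<tau>' | (\<tau>, \<tau>') \<in> down_edges V S q.
        of_int (\<theta> \<tau> * \<theta> \<tau>') * (down_weight V S q \<tau> \<tau>' * g \<tau>'))"
  by (simp add: switched_def switching_def down_discriminant_weight sum_distrib_left mult_ac)

text \<open>The sums agree term by term, for arbitrary \<open>g\<close>; at points outside the graph
  both are empty.\<close>

lemma switched_discriminant_uminus:
  assumes "\<And>\<tau> \<tau>'. (\<tau>, \<tau>') \<in> down_edges V S q \<Longrightarrow> \<theta> \<tau> * \<theta> \<tau>' = -1"
  shows "switched \<theta> (down_discriminant V S q) g = (\<lambda>\<tau>. - down_discriminant V S q g \<tau>)"
proof
  fix \<tau>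
  show "switched \<theta> (down_discriminant V S q) g \<tau> = - down_discriminant V S q g \<tau>"
    unfolding switched_discriminant down_discriminant_weight sum_negf[symmetric]
    \<comment> \<open>Without \<open>of_int_mult\<close> the product of the two signs stays intact
      and is rewritten to -1.\<close>
    by (rule sum.cong[OF refl]) (simp add: assms del: of_int_mult)
qed

text \<open>Evaluating the operator identity at \<open>\<tau>\<close> on the point mass at
  \<open>\<tau>'\<close> isolates one matrix entry, which is nonzero and cancels.\<close>

lemma switching_sign_change:
  assumes "simplicial_complex V S" "finite V" "1 \<le> q"
    and "\<forall>g\<in>ell2 (oriented_simplices V S q).
           switched \<theta> (down_discriminant V S q) g = (\<lambda>\<tau>. - down_discriminant V S q g \<tau>)"
    and edge: "(\<tau>, \<tau>') \<in> down_edges V S q"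
  shows "\<theta> \<tau> * \<theta> \<tau>' = -1"
proof -
  let ?X = "oriented_simplices V S q" and ?w = "down_weight V S q \<tau> \<tau>'"
  define g :: "'a oriented \<Rightarrow> complex" where "g = (\<lambda>x. if x = \<tau>' then 1 else 0)"
  have X: "finite ?X"
    using assms by (simp add: finite_oriented_simplices)
  have fin: "finite {\<tau>'. (\<tau>, \<tau>') \<in> down_edges V S q}"
    by (rule finite_subset[OF _ X]) (auto simp: down_edges_def)
  have "\<tau>' \<in> ?X" using edge by (auto simp: down_edges_def)
  then have "g \<in> ell2 ?X" using X by (auto simp: ell2_def g_def)
  then have "switched \<theta> (down_discriminant V S q) g \<tau> = - down_discriminant V S q g \<tau>"
    using assms(4) by simp
  then have "of_int (\<theta> \<tau> * \<theta> \<tau>') * ?w = - ?w"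
    using edge fin
    unfolding switched_discriminant down_discriminant_weight g_def
    \<comment> \<open>Moving the factors into the conditional reduces the finite sum to its term at
      \<open>\<tau>'\<close>.\<close>
    by (simp add: if_distrib[of "times _"] mult.assoc cong: if_cong)
  then have "of_int (\<theta> \<tau> * \<theta> \<tau>') * ?w = of_int (-1) * ?w"
    by simp
  then have "(of_int (\<theta> \<tau> * \<theta> \<tau>') :: complex) = of_int (-1)"
    using down_weight_nonzero[OF assms(1-3) edge] by (simp only: mult_cancel_right) simp
  then show ?thesis by (simp only: of_int_eq_iff)
qed

text \<open>The sign records whether a simplex has a down neighbor in \<open>B\<close>, so it
  depends on the underlying simplex only. On an edge this holds for the end in \<open>A\<close> and
  fails for the end in \<open>B\<close>. The values are 1 or -1 on the whole type.\<close>

lemma bipartite_sign_function: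
  assumes "bipartite (oriented_simplices V S q) (down_edges V S q)" "1 \<le> q"
  obtains \<theta> :: "'a oriented \<Rightarrow> int"
  where "\<And>\<tau>. \<theta> \<tau> \<in> {1, -1}"
    "\<And>\<tau>. \<tau> \<in> oriented_simplices V S q \<Longrightarrow> \<theta> (opposite \<tau>) = \<theta> \<tau>"
    "\<And>\<tau> \<tau>'. (\<tau>, \<tau>') \<in> down_edges V S q \<Longrightarrow> \<theta> \<tau> * \<theta> \<tau>' = -1"
proof -
  obtain A B where AB: "A \<union> B = oriented_simplices V S q" "A \<inter> B = {}"
    and "\<forall>(x, y)\<in>down_edges V S q. (x \<in> A \<and> y \<in> B) \<or> (x \<in> B \<and> y \<in> A)"
    using assms(1) unfolding bipartite_def by blast
  then have E: "(x \<in> A \<and> y \<in> B) \<or> (x \<in> B \<and> y \<in> A)" if "(x, y) \<in> down_edges V S q" for x y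
    using that by fast
  \<comment> \<open>The indicator of \<open>A\<close> itself need not be invariant under reversal at isolated vertices.\<close>
  define \<theta> :: "'a oriented \<Rightarrow> int" where
    "\<theta> \<tau> = (if \<exists>\<tau>'\<in>B. down_neighbors S q (underlying \<tau>) (underlying \<tau>') then 1 else -1)" for \<tau>
  have pos: "\<theta> \<tau> = 1" if "(\<tau>, \<tau>') \<in> down_edges V S q" "\<tau>' \<in> B" for \<tau> \<tau>'
    using that by (auto simp: \<theta>_def down_edges_def)
  have neg: "\<theta> \<tau> = -1" if "\<tau> \<in> B" for \<tau>
  proof -
    \<comment> \<open>Such a neighbor would give an edge inside \<open>B\<close>.\<close>
    have False if "\<tau>' \<in> B" "down_neighbors S q (underlying \<tau>) (underlying \<tau>')" for \<tau>'
    proof -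
      have "\<tau> \<in> oriented_simplices V S q" "\<tau>' \<in> oriented_simplices V S q"
        using that(1) \<open>\<tau> \<in> B\<close> AB(1) by blast+
      then have "(\<tau>, \<tau>') \<in> down_edges V S q"
        using that(2) by (simp add: down_edges_def)
      then show False using E[of \<tau> \<tau>'] that(1) \<open>\<tau> \<in> B\<close> AB(2) by blast
    qed
    then show ?thesis by (auto simp: \<theta>_def)
  qed
  show thesis
  proof
    show "\<theta> \<tau> \<in> {1, -1}" for \<tau> by (simp add: \<theta>_def)
    show "\<theta> (opposite \<tau>) = \<theta> \<tau>" if "\<tau> \<in> oriented_simplices V S q" for \<tau>
      using underlying_opposite[OF assms(2) that] by (simp add: \<theta>_def)
    show "\<theta> \<tau> * \<theta> \<tau>' = -1" if "(\<tau>, \<tau>') \<in> down_edges V S q" for \<tau> \<tau>'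
      using E[OF that]
    proof
      assume "\<tau> \<in> A \<and> \<tau>' \<in> B"
      then show ?thesis using pos[OF that] neg[of \<tau>'] by simp
    next
      assume "\<tau> \<in> B \<and> \<tau>' \<in> A"
      then show ?thesis using pos[OF down_edges_sym[OF that]] neg[of \<tau>] by simp
    qed
  qed
qed

section \<open>Symmetry of the spectrum\<close>

text \<open>As \<open>switching \<theta>\<close> is an involution,
  \<open>T (switching \<theta> g)\<close> is \<open>switching \<theta>\<close> applied to
  \<open>switched \<theta> T g\<close>, which equals \<open>- T g\<close>.\<close>

lemma eigenvalues_switched_uminus:
  assumes \<theta>: "\<And>x. \<theta> x \<in> {1, -1 :: int}"
    and H: "\<And>g. g \<in> H \<Longrightarrow> switching \<theta> g \<in> H"
    and neg: "\<And>g. g \<in> H \<Longrightarrow> switched \<theta> T g = (\<lambda>x. - T g x)"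
  shows "symmetric_about_origin (eigenvalues H T)"
proof -
  have sq: "of_int (\<theta> x) * (of_int (\<theta> x) * c) = (c :: complex)" for x c
    using \<theta>[of x] by auto
  have "- z \<in> eigenvalues H T" if z: "z \<in> eigenvalues H T" for z
  proof -
    obtain g where g: "g \<in> H" "g \<noteq> (\<lambda>_. 0)" "T g = (\<lambda>x. z * g x)"
      using z by (auto simp: eigenvalues_def)
    have "T (switching \<theta> g) x = - z * switching \<theta> g x" for x
    proof -
      have "T (switching \<theta> g) x = of_int (\<theta> x) * switched \<theta> T g x"
        by (simp add: switched_def switching_def sq)
      also have "\<dots> = - z * switching \<theta> g x"
        using neg[OF g(1)] g(3) by (simp add: switching_def)
      finally show ?thesis .
    qed
    moreover have "switching \<theta> g \<noteq> (\<lambda>_. 0)"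
    proof
      assume "switching \<theta> g = (\<lambda>_. 0)"
      then have "of_int (\<theta> x) * g x = 0" for x
        by (auto simp: switching_def fun_eq_iff)
      \<comment> \<open>Multiplying by the sign once more recovers \<open>g x\<close>.\<close>
      then have "g x = 0" for x using sq[of x "g x"] by (metis mult_zero_right)
      then show False using g(2) by auto
    qed
    ultimately show ?thesis
      using H[OF g(1)] by (auto simp: eigenvalues_def)
  qed
  \<comment> \<open>Closure under negation gives both inclusions, since negation is an
    involution.\<close>
  then show ?thesis
    unfolding symmetric_about_origin_def by (force simp: image_iff)
qed

lemma switching_ell2:
  assumes "\<And>x. \<theta> x \<in> {1, -1 :: int}" "g \<in> ell2 X"
  shows "switching \<theta> g \<in> ell2 X"
proof -
  have "cmod (switching \<theta> g x) = cmod (g x)" for x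
    using assms(1)[of x] by (auto simp: switching_def)
  then show ?thesis using assms(2) by (simp add: ell2_def switching_def)
qed

section \<open>Bipartiteness, switching and the spectrum\<close>

theorem theorem6p3:
  fixes V :: "'a set" and S :: "'a set set" and q :: nat
  assumes "standing_complex V S"
    and "finite V"
    and "1 \<le> q" and "q \<le> complex_dim S"
    and "q = complex_dim S \<Longrightarrow> 2 \<le> card (simplices S q)"
  shows "((\<exists>\<theta> :: 'a oriented \<Rightarrow> int.
             \<theta> \<in> oriented_simplices V S q \<rightarrow> {1, -1} \<and>
             (\<forall>\<tau>\<in>oriented_simplices V S q. \<theta> (opposite \<tau>) = \<theta> \<tau>) \<and>
             (\<forall>g\<in>ell2 (oriented_simplices V S q).
                switched \<theta> (down_discriminant V S q) g = (\<lambda>\<tau>. - down_discriminant V S q g \<tau>)))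
           \<longleftrightarrow> bipartite (oriented_simplices V S q) (down_edges V S q))
         \<and> (bipartite (oriented_simplices V S q) (down_edges V S q) \<longrightarrow>
              symmetric_about_origin
                (eigenvalues (ell2 (oriented_simplices V S q)) (down_discriminant V S q)))"
proof (intro conjI iffI impI)
  let ?X = "oriented_simplices V S q" and ?D = "down_discriminant V S q"
  have sc: "simplicial_complex V S"
    using assms(1) by (simp add: standing_complex_def)
  {
    assume "\<exists>\<theta> :: 'a oriented \<Rightarrow> int. \<theta> \<in> ?X \<rightarrow> {1, -1} \<and>
        (\<forall>\<tau>\<in>?X. \<theta> (opposite \<tau>) = \<theta> \<tau>) \<and>
        (\<forall>g\<in>ell2 ?X. switched \<theta> ?D g = (\<lambda>\<tau>. - ?D g \<tau>))"
    then obtain \<theta> :: "'a oriented \<Rightarrow> int" where \<theta>: "\<theta> \<in> ?X \<rightarrow> {1, -1}"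
      and neg: "\<forall>g\<in>ell2 ?X. switched \<theta> ?D g = (\<lambda>\<tau>. - ?D g \<tau>)"
      by blast
    let ?A = "{\<tau>\<in>?X. \<theta> \<tau> = 1}" and ?B = "{\<tau>\<in>?X. \<theta> \<tau> = -1}"
    have "(\<theta> \<tau> = 1 \<and> \<theta> \<tau>' = -1) \<or> (\<theta> \<tau> = -1 \<and> \<theta> \<tau>' = 1)" "\<tau> \<in> ?X" "\<tau>' \<in> ?X"
      if "(\<tau>, \<tau>') \<in> down_edges V S q" for \<tau> \<tau>'
    proof -
      show X: "\<tau> \<in> ?X" "\<tau>' \<in> ?X" using that by (auto simp: down_edges_def)
      show "(\<theta> \<tau> = 1 \<and> \<theta> \<tau>' = -1) \<or> (\<theta> \<tau> = -1 \<and> \<theta> \<tau>' = 1)"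
        using switching_sign_change[OF sc assms(2,3) neg that]
          Pi_mem[OF \<theta> X(1)] Pi_mem[OF \<theta> X(2)] by auto
    qed
    then have "\<forall>(\<tau>, \<tau>')\<in>down_edges V S q. (\<tau> \<in> ?A \<and> \<tau>' \<in> ?B) \<or> (\<tau> \<in> ?B \<and> \<tau>' \<in> ?A)"
      by auto
    moreover have "?A \<union> ?B = ?X" "?A \<inter> ?B = {}"
      using Pi_mem[OF \<theta>] by auto
    ultimately show "bipartite ?X (down_edges V S q)"
      unfolding bipartite_def by blast
  next
    assume bip: "bipartite ?X (down_edges V S q)"
    obtain \<theta> :: "'a oriented \<Rightarrow> int" where \<theta>: "\<And>\<tau>. \<theta> \<tau> \<in> {1, -1}"
      "\<And>\<tau>. \<tau> \<in> ?X \<Longrightarrow> \<theta> (opposite \<tau>) = \<theta> \<tau>"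
      "\<And>\<tau> \<tau>'. (\<tau>, \<tau>') \<in> down_edges V S q \<Longrightarrow> \<theta> \<tau> * \<theta> \<tau>' = -1"
      using bipartite_sign_function[OF bip assms(3)] by metis
    show "\<exists>\<theta> :: 'a oriented \<Rightarrow> int. \<theta> \<in> ?X \<rightarrow> {1, -1} \<and>
        (\<forall>\<tau>\<in>?X. \<theta> (opposite \<tau>) = \<theta> \<tau>) \<and>
        (\<forall>g\<in>ell2 ?X. switched \<theta> ?D g = (\<lambda>\<tau>. - ?D g \<tau>))"
    proof (intro exI conjI ballI)
      show "\<theta> \<in> ?X \<rightarrow> {1, -1}" using \<theta>(1) by (rule Pi_I)
      show "\<theta> (opposite \<tau>) = \<theta> \<tau>" if "\<tau> \<in> ?X" for \<tau> using \<theta>(2) that .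
      show "switched \<theta> ?D g = (\<lambda>\<tau>. - ?D g \<tau>)" for g
        using \<theta>(3) by (rule switched_discriminant_uminus)
    qed
  next
    assume bip: "bipartite ?X (down_edges V S q)"
    \<comment> \<open>The sign function is taken from the bipartition again because here its values
      must be 1 or -1 on the whole type, not only on \<open>?X\<close>.\<close>
    obtain \<theta> :: "'a oriented \<Rightarrow> int" where \<theta>: "\<And>\<tau>. \<theta> \<tau> \<in> {1, -1}"
      "\<And>\<tau> \<tau>'. (\<tau>, \<tau>') \<in> down_edges V S q \<Longrightarrow> \<theta> \<tau> * \<theta> \<tau>' = -1"
      using bipartite_sign_function[OF bip assms(3)] by metis
    show "symmetric_about_origin (eigenvalues (ell2 ?X) ?D)"
      using \<theta>(1) switching_ell2[OF \<theta>(1)] switched_discriminant_uminus[OF \<theta>(2)]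
      by (rule eigenvalues_switched_uminus)
  }
qed

end
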